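(* Let $\theta:\mathbb{R}^n\to(-\infty,\infty]$ be a closed proper convex function and let $F(x)=Mx+q$ with $M\in\mathbb{R}^{n\times n}$, $q\in\mathbb{R}^n$, such that $\mathrm{MGVI}(\theta,F)$ has at least one solution. Let $\gamma\in(0,2)$. (i) Suppose $M$ is positive semi-definite (not necessarily symmetric), i.e. $z^TMz\ge 0$ for all $z\in\mathbb{R}^n$. Let $\{x^k\}_k$ be a sequence generated by the algorithm $\mathrm{PGA}_{a_1}$ (defined in the context) from an arbitrary starting point, with step sizes $\{\beta^k\}_k$ that are bounded and satisfy $\inf_k\beta^k>0$. Then $\{x^k\}_k$ converges to a solution of $\mathrm{MGVI}(\theta,F)$. (ii) Suppose $M$ is symmetric positive semi-definite. Let $\beta>0$ and let $\{y^k\}_k$ be a sequence generated by the algorithm $\mathrm{PGA}_{a_2}$ (defined in the context) from an arbitrary starting point. Then $\{y^k\}_k$ converges to a solution of $\mathrm{MGVI}(\theta,F)$.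
   Context: $\mathbb{R}^n$ carries the standard inner product and Euclidean norm $\|\cdot\|$; for a symmetric positive definite matrix $G$, $\|x\|_G^2=x^TGx$. A function is closed proper convex if its epigraph is closed and convex and its effective domain $\{x:\theta(x)<\infty\}$ is nonempty. A solution of $\mathrm{MGVI}(\theta,F)$ is a point $x^*\in\mathbb{R}^n$ with $\theta(x)-\theta(x^* )+(x-x^* )^TF(x^* )\ge 0$ for all $x\in\mathbb{R}^n$ (with the convention $\infty-\infty=\infty$). For a closed proper convex $f$, $\mathrm{Prox}_f(x)$ is the unique minimizer over $y\in\mathbb{R}^n$ of $f(y)+\frac12\|x-y\|^2$. Algorithm $\mathrm{PGA}_{a_1}$: given $x^0\in\mathbb{R}^n$ and $\gamma\in(0,2)$, for $k=0,1,2,\dots$: (Predictor) select $\beta^k>0$ and set $\tilde x^k=\mathrm{Prox}_{\beta^k\theta}(x^k-\beta^kF(x^k))$; (Corrector) set $d^k=(I+\beta^kM^T)(x^k-\tilde x^k)$, $\alpha_k^*=\dfrac{\|x^k-\tilde x^k\|^2}{\|d^k\|^2}$, and $x^{k+1}=x^k-\gamma\alpha_k^*d^k$. Algorithm $\mathrm{PGA}_{a_2}$ (iterates again denoted $x^k$): given $x^0\in\mathbb{R}^n$, $\beta>0$ and $\gamma\in(0,2)$, with $G=I+\beta M^T$, for $k=0,1,2,\dots$: (Predictor) set $\tilde x^k=\mathrm{Prox}_{\beta\theta}(x^k-\beta F(x^k))$; (Corrector) set $d^k=x^k-\tilde x^k$, $\alpha_k^*=\dfrac{\|x^k-\tilde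 x^k\|^2}{\|d^k\|_G^2}$, and $x^{k+1}=x^k-\gamma\alpha_k^*d^k$. Convention: in both algorithms, if $x^k=\tilde x^k$ (so that $\alpha_k^*$ is $0/0$), then $x^{k+1}=x^k$. *)

theory Defs
  imports "HOL-Analysis.Analysis"
begin

(* The library's epigraph is for real-valued functions only. *)
definition ereal_epigraph :: "('a \<Rightarrow> ereal) \<Rightarrow> ('a \<times> real) set" where
  "ereal_epigraph f = {(x, r). f x \<le> ereal r}"

definition effective_domain :: "('a \<Rightarrow> ereal) \<Rightarrow> 'a set" where
  "effective_domain f = {x. f x < \<infinity>}"

(* The first conjunct says that f takes values in the half-open range (-infinity, infinity]. *)
definition closed_proper_convex :: "('a::euclidean_space \<Rightarrow> ereal) \<Rightarrow> bool" where
  "closed_proper_convex f \<longleftrightarrow>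
     (\<forall>x. f x \<noteq> -\<infinity>) \<and> closed (ereal_epigraph f) \<and> convex (ereal_epigraph f) \<and>
     effective_domain f \<noteq> {}"

(* Subtraction on ereal satisfies infinity - infinity = infinity, which is the
   convention intended here. *)
definition MGVI_solution ::
    "(real ^ 'n \<Rightarrow> ereal) \<Rightarrow> (real ^ 'n \<Rightarrow> real ^ 'n) \<Rightarrow> real ^ 'n \<Rightarrow> bool" where
  "MGVI_solution \<theta> F xs \<longleftrightarrow> (\<forall>x. \<theta> x - \<theta> xs + ereal ((x - xs) \<bullet> F xs) \<ge> 0)"

(* Meaningful when the minimizer exists and is unique, in particular for f closed proper convex. *)
definition prox :: "('a::euclidean_space \<Rightarrow> ereal) \<Rightarrow> 'a \<Rightarrow> 'a" where
  "prox f x = (THE y. is_arg_min (\<lambda>y. f y + ereal (1 / 2 * (norm (x - y))\<^sup>2)) (\<lambda>_. True) y)"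

(* No symmetry is required. *)
definition pos_semidef :: "real ^ 'n ^ 'n \<Rightarrow> bool" where
  "pos_semidef M \<longleftrightarrow> (\<forall>z. z \<bullet> (M *v z) \<ge> 0)"

definition weighted_norm_sq :: "real ^ 'n ^ 'n \<Rightarrow> real ^ 'n \<Rightarrow> real" where
  "weighted_norm_sq G x = x \<bullet> (G *v x)"

definition affine_map :: "real ^ 'n ^ 'n \<Rightarrow> real ^ 'n \<Rightarrow> real ^ 'n \<Rightarrow> real ^ 'n" where
  "affine_map M q x = M *v x + q"

definition predictor ::
    "(real ^ 'n \<Rightarrow> ereal) \<Rightarrow> (real ^ 'n \<Rightarrow> real ^ 'n) \<Rightarrow> real \<Rightarrow> real ^ 'n \<Rightarrow> real ^ 'n" where
  "predictor \<theta> F \<beta> x = prox (\<lambda>y. ereal \<beta> * \<theta> y) (x - \<beta> *\<^sub>R F x)"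

(* PGA_a1 and PGA_a2 say that the sequence x is generated by the respective algorithm,
   started at x 0.  The relaxation parameter lies in (0,2) and, for PGA_a2, the step size is
   positive; these are hypotheses wherever the predicates are used. *)
definition PGA_a1 ::
    "(real ^ 'n \<Rightarrow> ereal) \<Rightarrow> real ^ 'n ^ 'n \<Rightarrow> real ^ 'n \<Rightarrow> real \<Rightarrow> (nat \<Rightarrow> real) \<Rightarrow>
     (nat \<Rightarrow> real ^ 'n) \<Rightarrow> bool" where
  "PGA_a1 \<theta> M q \<gamma> \<beta> x \<longleftrightarrow> (\<forall>k. \<beta> k > 0 \<and>
     (let xt = predictor \<theta> (affine_map M q) (\<beta> k) (x k);
          d = (mat 1 + \<beta> k *\<^sub>R transpose M) *v (x k - xt);
          \<alpha> = (norm (x k - xt))\<^sup>2 / (norm d)\<^sup>2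
      in x (Suc k) = (if x k = xt then x k else x k - (\<gamma> * \<alpha>) *\<^sub>R d)))"

definition PGA_a2 ::
    "(real ^ 'n \<Rightarrow> ereal) \<Rightarrow> real ^ 'n ^ 'n \<Rightarrow> real ^ 'n \<Rightarrow> real \<Rightarrow> real \<Rightarrow>
     (nat \<Rightarrow> real ^ 'n) \<Rightarrow> bool" where
  "PGA_a2 \<theta> M q \<gamma> \<beta> x \<longleftrightarrow> (\<forall>k.
     let G = mat 1 + \<beta> *\<^sub>R transpose M;
         xt = predictor \<theta> (affine_map M q) \<beta> (x k);
         d = x k - xt;
         \<alpha> = (norm (x k - xt))\<^sup>2 / weighted_norm_sq G d
     in x (Suc k) = (if x k = xt then x k else x k - (\<gamma> * \<alpha>) *\<^sub>R d))"

end

theory Submission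
  imports Defs
begin

text \<open>
  Write \<open>F x = M x + q\<close>, \<open>e = x - p\<close> for the predictor residual at \<open>x\<close>, and
  \<open>d = (I + \<beta> M\<^sup>T) e\<close>.  A predictor \<open>p\<close> is characterised by the inclusion
  \<open>e / \<beta> - F x \<in> \<partial>\<theta> p\<close>, and a solution \<open>xs\<close> by \<open>- F xs \<in> \<partial>\<theta> xs\<close>.  Monotonicity of the
  subdifferential and positive semidefiniteness of \<open>M\<close> then give the key inequality
  \<open>(x - xs) \<bullet> d \<ge> \<parallel>e\<parallel>\<^sup>2\<close> (lemma \<open>predictor_descent\<close>): \<open>- d\<close> points from \<open>x\<close> towards every
  solution at once.

  Both algorithms are the same method in two different metrics: the corrector moves along \<open>- w\<close>,
  where \<open>G w = d\<close> for a symmetric \<open>G \<ge> I\<close>, and distances are measured by \<open>z \<bullet> G z\<close>.  For the first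
  algorithm \<open>G = I\<close> and \<open>w = d\<close>; for the second \<open>G = I + \<beta> M\<close>, which is symmetric because \<open>M\<close> is,
  and \<open>w = e\<close>.  The step length \<open>\<alpha> = \<parallel>e\<parallel>\<^sup>2 / (w \<bullet> G w)\<close> minimises the upper bound
  \<open>- 2 \<alpha> \<parallel>e\<parallel>\<^sup>2 + \<alpha>\<^sup>2 (w \<bullet> G w)\<close> on the change of the squared \<open>G\<close>-distance to a solution, so relaxing it
  by \<open>\<gamma> \<in> (0,2)\<close> still decreases that distance by at least \<open>\<gamma> (2 - \<gamma>) \<alpha> \<parallel>e\<parallel>\<^sup>2\<close>.  Since
  \<open>w \<bullet> G w \<le> K \<parallel>e\<parallel>\<^sup>2\<close> with \<open>K\<close> independent of the iteration, the decrease is at least a fixed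
  multiple of \<open>\<parallel>e\<parallel>\<^sup>2\<close>.

  Hence the iterates are Fejer monotone with respect to the solution set and the residuals tend to
  zero.  The graph of \<open>\<partial>\<theta>\<close> is closed, so every cluster point is a solution, and a Fejer monotone
  sequence converges as soon as its cluster points lie in the target set (lemma
  \<open>fejer_convergent\<close>).

  The inclusion \<open>- v \<in> \<partial>\<theta> a\<close> is expressed below as \<open>MGVI_solution \<theta> (\<lambda>_. v) a\<close>.
\<close>

section \<open>Subgradients through the epigraph\<close>

lemma MGVI_solution_const: "MGVI_solution \<theta> F a \<longleftrightarrow> MGVI_solution \<theta> (\<lambda>_. F a) a"
  by (simp add: MGVI_solution_def)

text \<open>
  Moving the inequality into the epigraph removes all arithmetic with infinite values and makes
  closedness under limits immediate.  The right-hand side also forces \<open>a\<close> into the effective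
  domain, because the epigraph is nonempty.
\<close>

lemma MGVI_solution_epigraph:
  fixes \<theta> :: "real ^ 'n \<Rightarrow> ereal"
  assumes cpc: "closed_proper_convex \<theta>"
  shows "MGVI_solution \<theta> F a \<longleftrightarrow>
    (\<forall>y r. (y, r) \<in> ereal_epigraph \<theta> \<longrightarrow> (a, r + (y - a) \<bullet> F a) \<in> ereal_epigraph \<theta>)"
    (is "?L \<longleftrightarrow> ?R")
proof -
  have ninf: "\<theta> y \<noteq> -\<infinity>" for y using cpc by (auto simp: closed_proper_convex_def)
  obtain x0 where x0: "\<theta> x0 < \<infinity>"
    using cpc by (auto simp: closed_proper_convex_def effective_domain_def)
  obtain t0 where t0: "\<theta> x0 = ereal t0" using x0 ninf[of x0] by (cases "\<theta> x0") auto
  show ?thesis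
  proof
    assume L: ?L
    have "\<theta> a \<noteq> \<infinity>"
      using L[unfolded MGVI_solution_def, rule_format, of x0] t0 by auto
    then obtain s where s: "\<theta> a = ereal s" using ninf[of a] by (cases "\<theta> a") auto
    show ?R
    proof (intro allI impI)
      fix y r assume yr: "(y, r) \<in> ereal_epigraph \<theta>"
      then obtain t where t: "\<theta> y = ereal t" "t \<le> r"
        using ninf[of y] by (cases "\<theta> y") (auto simp: ereal_epigraph_def)
      show "(a, r + (y - a) \<bullet> F a) \<in> ereal_epigraph \<theta>"
        using L[unfolded MGVI_solution_def, rule_format, of y] t s by (auto simp: ereal_epigraph_def)
    qed
  next
    assume R: ?R
    have "\<theta> a \<noteq> \<infinity>" using R[rule_format, of x0 t0] t0 by (auto simp: ereal_epigraph_def)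
    then obtain s where s: "\<theta> a = ereal s" using ninf[of a] by (cases "\<theta> a") auto
    show ?L unfolding MGVI_solution_def
    proof
      fix y
      show "0 \<le> \<theta> y - \<theta> a + ereal ((y - a) \<bullet> F a)"
      proof (cases "\<theta> y")
        case (real t)
        then show ?thesis using R[rule_format, of y t] s by (auto simp: ereal_epigraph_def)
      qed (use ninf[of y] s in auto)
    qed
  qed
qed

lemma MGVI_solution_finite:
  fixes \<theta> :: "real ^ 'n \<Rightarrow> ereal"
  assumes cpc: "closed_proper_convex \<theta>" and "MGVI_solution \<theta> F a"
  obtains s where "\<theta> a = ereal s"
proof -
  obtain x0 where x0: "\<theta> x0 < \<infinity>"
    using cpc by (auto simp: closed_proper_convex_def effective_domain_def)
  have ninf: "\<theta> y \<noteq> -\<infinity>" for y using cpc by (auto simp: closed_proper_convex_def)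
  obtain t0 where t0: "\<theta> x0 = ereal t0" using x0 ninf[of x0] by (cases "\<theta> x0") auto
  have "\<theta> a \<noteq> \<infinity>"
    using assms(2)[unfolded MGVI_solution_def, rule_format, of x0] t0 by auto
  then show thesis using that ninf[of a] by (cases "\<theta> a") auto
qed

text \<open>Monotonicity of the subdifferential; the sign is reversed because \<open>v\<close> and \<open>w\<close> are negatives
  of subgradients.\<close>

lemma MGVI_solution_antimono:
  fixes \<theta> :: "real ^ 'n \<Rightarrow> ereal"
  assumes cpc: "closed_proper_convex \<theta>"
    and a: "MGVI_solution \<theta> (\<lambda>_. v) a" and b: "MGVI_solution \<theta> (\<lambda>_. w) b"
  shows "(a - b) \<bullet> (v - w) \<le> 0"
proof -
  obtain s where s: "\<theta> a = ereal s" using MGVI_solution_finite[OF cpc a] .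
  have "(a, s) \<in> ereal_epigraph \<theta>" using s by (simp add: ereal_epigraph_def)
  then have "(b, s + (a - b) \<bullet> w) \<in> ereal_epigraph \<theta>"
    using iffD1[OF MGVI_solution_epigraph[OF cpc] b] by blast
  then have "(a, s + (a - b) \<bullet> w + (b - a) \<bullet> v) \<in> ereal_epigraph \<theta>"
    using iffD1[OF MGVI_solution_epigraph[OF cpc] a] by blast
  then show ?thesis using s by (simp add: ereal_epigraph_def inner_simps)
qed

text \<open>The graph of the subdifferential is closed, because the epigraph is.\<close>

lemma MGVI_solution_limit:
  fixes \<theta> :: "real ^ 'n \<Rightarrow> ereal" and a v :: "nat \<Rightarrow> real ^ 'n"
  assumes cpc: "closed_proper_convex \<theta>"
    and sol: "\<And>k. MGVI_solution \<theta> (\<lambda>_. v k) (a k)"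
    and lim: "a \<longlonglongrightarrow> a'" "v \<longlonglongrightarrow> v'"
  shows "MGVI_solution \<theta> (\<lambda>_. v') a'"
  unfolding MGVI_solution_epigraph[OF cpc]
proof (intro allI impI)
  fix y r assume yr: "(y, r) \<in> ereal_epigraph \<theta>"
  have cl: "closed (ereal_epigraph \<theta>)" using cpc by (simp add: closed_proper_convex_def)
  have mem: "(a k, r + (y - a k) \<bullet> v k) \<in> ereal_epigraph \<theta>" for k
    using sol[of k] yr unfolding MGVI_solution_epigraph[OF cpc] by blast
  have "(\<lambda>k. (a k, r + (y - a k) \<bullet> v k)) \<longlonglongrightarrow> (a', r + (y - a') \<bullet> v')"
    by (intro tendsto_intros lim)
  then show "(a', r + (y - a') \<bullet> v') \<in> ereal_epigraph \<theta>"
    using closed_sequentially[OF cl, of "\<lambda>k. (a k, r + (y - a k) \<bullet> v k)"] mem by simp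
qed

section \<open>The proximal map\<close>

lemma prox_minimizer_epigraph:
  fixes \<theta> :: "real ^ 'n \<Rightarrow> ereal"
  assumes cpc: "closed_proper_convex \<theta>" and \<beta>: "\<beta> > 0"
  shows "is_arg_min (\<lambda>y. ereal \<beta> * \<theta> y + ereal (1 / 2 * (norm (z - y))\<^sup>2)) (\<lambda>_. True) p \<longleftrightarrow>
    (\<exists>s. (p, s) \<in> ereal_epigraph \<theta> \<and> (\<forall>y r. (y, r) \<in> ereal_epigraph \<theta> \<longrightarrow>
      \<beta> * s + 1 / 2 * (norm (z - p))\<^sup>2 \<le> \<beta> * r + 1 / 2 * (norm (z - y))\<^sup>2))"
    (is "?L \<longleftrightarrow> ?R")
proof -
  have ninf: "\<theta> y \<noteq> -\<infinity>" for y using cpc by (auto simp: closed_proper_convex_def)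
  obtain x0 where x0: "\<theta> x0 < \<infinity>"
    using cpc by (auto simp: closed_proper_convex_def effective_domain_def)
  obtain t0 where t0: "\<theta> x0 = ereal t0" using x0 ninf[of x0] by (cases "\<theta> x0") auto
  show ?thesis
  proof
    assume ?L
    then have le: "ereal \<beta> * \<theta> p + ereal (1 / 2 * (norm (z - p))\<^sup>2)
        \<le> ereal \<beta> * \<theta> y + ereal (1 / 2 * (norm (z - y))\<^sup>2)" for y
      by (auto simp: is_arg_min_def not_less)
    have "\<theta> p \<noteq> \<infinity>" using le[of x0] t0 \<beta> by auto
    then obtain s where s: "\<theta> p = ereal s" using ninf[of p] by (cases "\<theta> p") auto
    show ?R
    proof (intro exI[of _ s] conjI allI impI)
      show "(p, s) \<in> ereal_epigraph \<theta>" using s by (simp add: ereal_epigraph_def)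
      fix y r assume "(y, r) \<in> ereal_epigraph \<theta>"
      then obtain t where t: "\<theta> y = ereal t" "t \<le> r"
        using ninf[of y] by (cases "\<theta> y") (auto simp: ereal_epigraph_def)
      have "\<beta> * t \<le> \<beta> * r" using t \<beta> by simp
      moreover have "\<beta> * s + 1 / 2 * (norm (z - p))\<^sup>2 \<le> \<beta> * t + 1 / 2 * (norm (z - y))\<^sup>2"
        using le[of y] s t by simp
      ultimately show "\<beta> * s + 1 / 2 * (norm (z - p))\<^sup>2 \<le> \<beta> * r + 1 / 2 * (norm (z - y))\<^sup>2"
        by linarith
    qed
  next
    assume ?R
    then obtain s where s: "(p, s) \<in> ereal_epigraph \<theta>" and
      le: "\<And>y r. (y, r) \<in> ereal_epigraph \<theta> \<Longrightarrow>
        \<beta> * s + 1 / 2 * (norm (z - p))\<^sup>2 \<le> \<beta> * r + 1 / 2 * (norm (z - y))\<^sup>2" by blast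
    obtain s' where s': "\<theta> p = ereal s'" "s' \<le> s"
      using s ninf[of p] by (cases "\<theta> p") (auto simp: ereal_epigraph_def)
    have "\<beta> * s' \<le> \<beta> * s" using s' \<beta> by simp
    show ?L unfolding is_arg_min_def
    proof (intro conjI TrueI notI, elim exE conjE)
      fix y assume lt: "ereal \<beta> * \<theta> y + ereal (1 / 2 * (norm (z - y))\<^sup>2)
        < ereal \<beta> * \<theta> p + ereal (1 / 2 * (norm (z - p))\<^sup>2)"
      have "\<theta> y \<noteq> \<infinity>" using lt \<beta> by auto
      then obtain t where t: "\<theta> y = ereal t" using ninf[of y] by (cases "\<theta> y") auto
      then have "(y, t) \<in> ereal_epigraph \<theta>" by (simp add: ereal_epigraph_def)
      from le[OF this] lt t s' \<open>\<beta> * s' \<le> \<beta> * s\<close> show False by simp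
    qed
  qed
qed

text \<open>First-order optimality: compare the minimiser \<open>p\<close> with \<open>p + t (y - p)\<close>, divide by \<open>t\<close> and let
  \<open>t\<close> tend to zero.\<close>

lemma prox_minimizer_subgradient:
  fixes \<theta> :: "real ^ 'n \<Rightarrow> ereal"
  assumes cpc: "closed_proper_convex \<theta>" and \<beta>: "\<beta> > 0"
    and min: "is_arg_min (\<lambda>y. ereal \<beta> * \<theta> y + ereal (1 / 2 * (norm (z - y))\<^sup>2)) (\<lambda>_. True) p"
  shows "MGVI_solution \<theta> (\<lambda>_. (1 / \<beta>) *\<^sub>R (p - z)) p"
  unfolding MGVI_solution_epigraph[OF cpc]
proof (intro allI impI)
  fix y r assume yr: "(y, r) \<in> ereal_epigraph \<theta>"
  obtain s where s: "(p, s) \<in> ereal_epigraph \<theta>" and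
    le: "\<And>y r. (y, r) \<in> ereal_epigraph \<theta> \<Longrightarrow>
        \<beta> * s + 1 / 2 * (norm (z - p))\<^sup>2 \<le> \<beta> * r + 1 / 2 * (norm (z - y))\<^sup>2"
    using min unfolding prox_minimizer_epigraph[OF cpc \<beta>] by blast
  have cvx: "convex (ereal_epigraph \<theta>)" using cpc by (simp add: closed_proper_convex_def)
  define A where "A = \<beta> * (r - s) + (y - p) \<bullet> (p - z)"
  define B where "B = (norm (y - p))\<^sup>2 / 2"
  have pos: "0 \<le> A + t * B" if t: "0 < t" "t < 1" for t
  proof -
    have "(1 - t) *\<^sub>R (p, s) + t *\<^sub>R (y, r) \<in> ereal_epigraph \<theta>"
      using cvx s yr t by (intro convexD) auto
    then have "((1 - t) *\<^sub>R p + t *\<^sub>R y, (1 - t) * s + t * r) \<in> ereal_epigraph \<theta>" by simp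
    from le[OF this]
    have "\<beta> * s + 1 / 2 * (norm (z - p))\<^sup>2
      \<le> \<beta> * ((1 - t) * s + t * r) + 1 / 2 * (norm ((z - p) - t *\<^sub>R (y - p)))\<^sup>2"
      by (simp add: algebra_simps)
    moreover have "(norm ((z - p) - t *\<^sub>R (y - p)))\<^sup>2
      = (norm (z - p))\<^sup>2 + 2 * t * ((y - p) \<bullet> (p - z)) + t\<^sup>2 * (norm (y - p))\<^sup>2"
      unfolding power2_norm_eq_inner
      by (simp add: inner_simps inner_commute power2_eq_square algebra_simps)
    ultimately have "0 \<le> t * (A + t * B)"
      by (simp add: A_def B_def power2_eq_square algebra_simps)
    then show ?thesis using t by (simp add: zero_le_mult_iff)
  qed
  have "((\<lambda>t. A + t * B) \<longlongrightarrow> A + 0 * B) (at_right 0)" by (intro tendsto_intros)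
  moreover have "eventually (\<lambda>t. 0 \<le> A + t * B) (at_right 0)"
    using eventually_at_right[of 0 "1::real"] pos by (auto intro: exI[of _ 1])
  ultimately have "0 \<le> A" using tendsto_lowerbound[of "\<lambda>t. A + t * B" A "at_right 0" 0] by simp
  then have "0 \<le> A / \<beta>" using \<beta> by simp
  also have "A / \<beta> = r - s + (y - p) \<bullet> ((1 / \<beta>) *\<^sub>R (p - z))"
    using \<beta> by (simp only: A_def inner_scaleR_right) (simp add: add_divide_distrib)
  finally have "s \<le> r + (y - p) \<bullet> ((1 / \<beta>) *\<^sub>R (p - z))" by linarith
  then show "(p, r + (y - p) \<bullet> ((1 / \<beta>) *\<^sub>R (p - z))) \<in> ereal_epigraph \<theta>"
    using s by (auto simp: ereal_epigraph_def elim: order_trans)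
qed

text \<open>Existence of the minimiser.  A subgradient somewhere gives an affine minorant of \<open>\<theta>\<close>; the
  quadratic term dominates it, so the sublevel sets of the objective, taken on the epigraph, are
  compact.  Any solution of the variational inequality provides such a subgradient.\<close>

lemma prox_minimizer_exists:
  fixes \<theta> :: "real ^ 'n \<Rightarrow> ereal"
  assumes cpc: "closed_proper_convex \<theta>" and \<beta>: "\<beta> > 0"
    and minorant: "MGVI_solution \<theta> (\<lambda>_. v) a"
  shows "\<exists>p. is_arg_min (\<lambda>y. ereal \<beta> * \<theta> y + ereal (1 / 2 * (norm (z - y))\<^sup>2)) (\<lambda>_. True) p"
proof -
  define E where "E = ereal_epigraph \<theta>"
  define g where "g = (\<lambda>w :: (real^'n) \<times> real. \<beta> * snd w + 1 / 2 * (norm (z - fst w))\<^sup>2)"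
  obtain s where s: "\<theta> a = ereal s" using MGVI_solution_finite[OF cpc minorant] .
  have as: "(a, s) \<in> E" by (simp add: E_def ereal_epigraph_def s)
  have lower: "s - (y - a) \<bullet> v \<le> r" if "(y, r) \<in> E" for y r
  proof -
    have "(a, r + (y - a) \<bullet> v) \<in> E"
      using that minorant unfolding MGVI_solution_epigraph[OF cpc] E_def by blast
    then have "s \<le> r + (y - a) \<bullet> v" by (simp add: E_def ereal_epigraph_def s)
    then show ?thesis by linarith
  qed
  define S where "S = E \<inter> {w. g w \<le> g (a, s)}"
  have contg: "continuous_on UNIV g" unfolding g_def by (intro continuous_intros)
  have "closed E" using cpc by (simp add: closed_proper_convex_def E_def)
  moreover have "closed {w. g w \<le> g (a, s)}"
    by (intro closed_Collect_le contg continuous_on_const)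
  ultimately have "closed S" by (auto simp: S_def)
  moreover have "bounded S"
  proof -
    (* Completing the square turns minorant plus quadratic term into half the squared distance
       to z + \<beta> v plus a constant. *)
    define c where "c = 2 * (g (a, s) - \<beta> * s - \<beta> * (a \<bullet> v) + \<beta> * (z \<bullet> v)) + \<beta>\<^sup>2 * (v \<bullet> v)"
    define R where "R = sqrt c + norm (z + \<beta> *\<^sub>R v)"
    have y_bound: "norm y \<le> R" if "(y, r) \<in> S" for y r
    proof -
      have "\<beta> * (s - (y - a) \<bullet> v) \<le> \<beta> * r" using lower[of y r] that \<beta> by (simp add: S_def)
      moreover have "\<beta> * r + 1 / 2 * (norm (z - y))\<^sup>2 \<le> g (a, s)"
        using that by (simp add: S_def g_def)
      ultimately have "2 * \<beta> * (s - (y - a) \<bullet> v) + (norm (z - y))\<^sup>2 \<le> 2 * g (a, s)" by linarith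
      then have "(norm (y - (z + \<beta> *\<^sub>R v)))\<^sup>2 \<le> c"
        unfolding power2_norm_eq_inner c_def
        by (simp add: inner_simps inner_commute power2_eq_square algebra_simps)
      then have "norm (y - (z + \<beta> *\<^sub>R v)) \<le> sqrt c" by (rule real_le_rsqrt)
      then show ?thesis using norm_triangle_sub[of y "z + \<beta> *\<^sub>R v"] by (simp add: R_def)
    qed
    have "S \<subseteq> cball 0 R \<times> {s - (R + norm a) * norm v .. g (a, s) / \<beta>}"
    proof (rule subrelI)
      fix y r assume yr: "(y, r) \<in> S"
      have "(y - a) \<bullet> v \<le> norm (y - a) * norm v" by (rule norm_cauchy_schwarz)
      also have "\<dots> \<le> (R + norm a) * norm v"
        using norm_triangle_ineq4[of y a] y_bound[OF yr] by (intro mult_right_mono) auto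
      finally have "s - (R + norm a) * norm v \<le> r" using lower[of y r] yr by (simp add: S_def)
      moreover have "\<beta> * r \<le> g (y, r)" by (simp add: g_def)
      moreover have "g (y, r) \<le> g (a, s)" using yr by (simp add: S_def)
      ultimately show "(y, r) \<in> cball 0 R \<times> {s - (R + norm a) * norm v .. g (a, s) / \<beta>}"
        using y_bound[OF yr] \<beta> by (simp add: field_simps)
    qed
    then show ?thesis by (rule bounded_subset[rotated]) (intro bounded_Times bounded_cball bounded_closed_interval)
  qed
  ultimately have "compact S" by (simp add: compact_eq_bounded_closed)
  moreover have "S \<noteq> {}" using as by (auto simp: S_def)
  moreover have "continuous_on S g" by (rule continuous_on_subset[OF contg subset_UNIV])
  ultimately have "\<exists>w\<in>S. \<forall>u\<in>S. g w \<le> g u" by (rule continuous_attains_inf)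
  then obtain w where w: "w \<in> S" "\<forall>u\<in>S. g w \<le> g u" by blast
  have all: "g w \<le> g u" if "u \<in> E" for u
  proof (cases "u \<in> S")
    case False
    then have "g (a, s) < g u" using that by (simp add: S_def)
    moreover have "g w \<le> g (a, s)" using w(1) by (simp add: S_def)
    ultimately show ?thesis by linarith
  qed (use w in auto)
  have "(fst w, snd w) \<in> ereal_epigraph \<theta> \<and> (\<forall>y r. (y, r) \<in> ereal_epigraph \<theta> \<longrightarrow>
      \<beta> * snd w + 1 / 2 * (norm (z - fst w))\<^sup>2 \<le> \<beta> * r + 1 / 2 * (norm (z - y))\<^sup>2)"
    using w(1) all by (auto simp: S_def E_def g_def)
  then show ?thesis unfolding prox_minimizer_epigraph[OF cpc \<beta>] by blast
qed

text \<open>Uniqueness of the minimiser follows from monotonicity, since two minimisers \<open>p\<close>, \<open>p'\<close> carry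
  subgradients that differ by a negative multiple of \<open>p - p'\<close>.\<close>

lemma prox_subgradient:
  fixes \<theta> :: "real ^ 'n \<Rightarrow> ereal"
  assumes cpc: "closed_proper_convex \<theta>" and \<beta>: "\<beta> > 0"
    and minorant: "MGVI_solution \<theta> (\<lambda>_. v) a"
    and p: "p = prox (\<lambda>y. ereal \<beta> * \<theta> y) z"
  shows "MGVI_solution \<theta> (\<lambda>_. (1 / \<beta>) *\<^sub>R (p - z)) p"
proof -
  let ?min = "is_arg_min (\<lambda>y. ereal \<beta> * \<theta> y + ereal (1 / 2 * (norm (z - y))\<^sup>2)) (\<lambda>_. True)"
  obtain p0 where p0: "?min p0" using prox_minimizer_exists[OF cpc \<beta> minorant] by blast
  have unique: "p1 = p0" if "?min p1" for p1
  proof -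
    have "(p1 - p0) \<bullet> ((1 / \<beta>) *\<^sub>R (p1 - z) - (1 / \<beta>) *\<^sub>R (p0 - z)) \<le> 0"
      by (intro MGVI_solution_antimono[OF cpc] prox_minimizer_subgradient[OF cpc \<beta>] that p0)
    also have "(1 / \<beta>) *\<^sub>R (p1 - z) - (1 / \<beta>) *\<^sub>R (p0 - z) = (1 / \<beta>) *\<^sub>R (p1 - p0)"
      by (simp add: algebra_simps)
    finally have "(p1 - p0) \<bullet> (p1 - p0) \<le> 0" using \<beta> by (simp add: divide_le_0_iff)
    then have "(p1 - p0) \<bullet> (p1 - p0) = 0" by (rule antisym) (rule inner_ge_zero)
    then show ?thesis by (simp only: inner_eq_zero_iff right_minus_eq)
  qed
  have "p = p0" unfolding p prox_def by (rule the_equality) (fact p0, rule unique)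
  then show ?thesis using prox_minimizer_subgradient[OF cpc \<beta> p0] by (rule ssubst)
qed

lemma predictor_subgradient:
  fixes \<theta> :: "real ^ 'n \<Rightarrow> ereal"
  assumes cpc: "closed_proper_convex \<theta>" and \<beta>: "\<beta> > 0"
    and sol: "MGVI_solution \<theta> F xs" and p: "p = predictor \<theta> F \<beta> x"
  shows "MGVI_solution \<theta> (\<lambda>_. F x - (1 / \<beta>) *\<^sub>R (x - p)) p"
proof -
  have "(1 / \<beta>) *\<^sub>R (p - (x - \<beta> *\<^sub>R F x)) = F x - (1 / \<beta>) *\<^sub>R (x - p)"
    using \<beta> by (simp add: algebra_simps)
  moreover have "MGVI_solution \<theta> (\<lambda>_. (1 / \<beta>) *\<^sub>R (p - (x - \<beta> *\<^sub>R F x))) p"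
    by (rule prox_subgradient[OF cpc \<beta> iffD1[OF MGVI_solution_const sol]])
      (simp only: p predictor_def)
  ultimately show ?thesis by (simp only:)
qed

section \<open>Descent towards the solution set\<close>

lemma inner_matrix_transpose:
  fixes A :: "real ^ 'n ^ 'm"
  shows "x \<bullet> (transpose A *v y) = (A *v x) \<bullet> y"
  by (metis dot_lmul_matrix inner_commute transpose_matrix_vector)

text \<open>The right-hand side exceeds the left-hand side by the sum of two nonnegative terms:
  \<open>(p - xs) \<bullet> (x - p - \<beta> M (x - xs))\<close>, by monotonicity of the subdifferential at \<open>p\<close> and \<open>xs\<close>,
  and \<open>\<beta> (x - xs) \<bullet> M (x - xs)\<close>, by positive semidefiniteness.\<close>

lemma predictor_descent:
  fixes \<theta> :: "real ^ 'n \<Rightarrow> ereal"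
  assumes cpc: "closed_proper_convex \<theta>" and psd: "pos_semidef M" and \<beta>: "\<beta> > 0"
    and sol: "MGVI_solution \<theta> (affine_map M q) xs"
    and p: "p = predictor \<theta> (affine_map M q) \<beta> x"
  shows "(norm (x - p))\<^sup>2 \<le> (x - xs) \<bullet> ((mat 1 + \<beta> *\<^sub>R transpose M) *v (x - p))"
proof -
  let ?F = "affine_map M q"
  have "MGVI_solution \<theta> (\<lambda>_. ?F xs) xs"
    by (rule iffD1[OF MGVI_solution_const sol])
  from MGVI_solution_antimono[OF cpc predictor_subgradient[OF cpc \<beta> sol p] this]
  have "(p - xs) \<bullet> (?F x - (1 / \<beta>) *\<^sub>R (x - p) - ?F xs) \<le> 0" .
  also have "?F x - (1 / \<beta>) *\<^sub>R (x - p) - ?F xs = M *v (x - xs) - (1 / \<beta>) *\<^sub>R (x - p)"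
    by (simp add: affine_map_def matrix_vector_mult_diff_distrib)
  finally have "(p - xs) \<bullet> (M *v (x - xs)) \<le> ((p - xs) \<bullet> (x - p)) / \<beta>"
    by (simp only: inner_diff_right[of _ _ "(1 / \<beta>) *\<^sub>R (x - p)"] inner_scaleR_right) simp
  then have mono: "\<beta> * ((p - xs) \<bullet> (M *v (x - xs))) \<le> (p - xs) \<bullet> (x - p)"
    using \<beta> by (simp add: pos_le_divide_eq mult.commute)
  have psd': "0 \<le> \<beta> * ((x - xs) \<bullet> (M *v (x - xs)))"
    using psd \<beta> by (simp add: pos_semidef_def)
  have "(x - xs) \<bullet> ((mat 1 + \<beta> *\<^sub>R transpose M) *v (x - p))
      = (x - xs) \<bullet> (x - p) + \<beta> * ((M *v (x - xs)) \<bullet> (x - p))"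
    by (simp add: matrix_vector_mult_add_rdistrib scaleR_matrix_vector_assoc[symmetric]
        inner_add_right inner_matrix_transpose del: transpose_matrix_vector)
  also have "(M *v (x - xs)) \<bullet> (x - p)
      = (x - xs) \<bullet> (M *v (x - xs)) - (p - xs) \<bullet> (M *v (x - xs))"
    by (simp add: inner_simps inner_commute)
  also have "(x - xs) \<bullet> (x - p) = (norm (x - p))\<^sup>2 + (p - xs) \<bullet> (x - p)"
    by (simp add: power2_norm_eq_inner inner_simps)
  finally show ?thesis using mono psd' by (simp add: right_diff_distrib)
qed

text \<open>One relaxed step with the optimal step length \<open>\<epsilon> / (w \<bullet> G w)\<close>; here \<open>\<epsilon>\<close> is the guaranteed
  slope of the squared distance along \<open>w\<close>, and \<open>u\<close> the displacement from a target point.\<close>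

lemma relaxed_step_decrease:
  fixes G :: "real ^ 'n ^ 'n" and u w :: "real ^ 'n"
  assumes sym: "transpose G = G" and G: "\<And>z. (norm z)\<^sup>2 \<le> weighted_norm_sq G z"
    and \<gamma>: "0 < \<gamma>" "\<gamma> < 2" and "0 \<le> \<epsilon>" and slope: "\<epsilon> \<le> u \<bullet> (G *v w)"
    and K: "0 < K" "weighted_norm_sq G w \<le> K * \<epsilon>"
  shows "weighted_norm_sq G (u - (\<gamma> * (\<epsilon> / weighted_norm_sq G w)) *\<^sub>R w)
    \<le> weighted_norm_sq G u - \<gamma> * (2 - \<gamma>) / K * \<epsilon>"
proof (cases "\<epsilon> = 0")
  case False
  then have \<epsilon>: "\<epsilon> > 0" using \<open>0 \<le> \<epsilon>\<close> by simp
  let ?V = "weighted_norm_sq G w"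
  define \<alpha> where "\<alpha> = \<epsilon> / ?V"
  have "w \<noteq> 0" using slope \<epsilon> by auto
  then have V: "?V > 0" using G[of w] by (smt (verit) zero_less_norm_iff zero_less_power)
  have \<alpha>: "\<alpha> * ?V = \<epsilon>" "\<alpha> > 0" using V \<epsilon> by (auto simp: \<alpha>_def)
  have "1 / K \<le> \<alpha>" using K V by (simp add: \<alpha>_def field_simps)
  then have gain: "\<gamma> * (2 - \<gamma>) / K * \<epsilon> \<le> \<gamma> * (2 - \<gamma>) * \<alpha> * \<epsilon>"
    using \<gamma> \<epsilon> mult_left_mono[of "1 / K" \<alpha> "\<gamma> * (2 - \<gamma>) * \<epsilon>"] by (simp add: mult.commute mult.left_commute)
  have swap: "w \<bullet> (G *v u) = u \<bullet> (G *v w)"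
    using inner_matrix_transpose[of w G u] sym by (simp add: inner_commute)
  have "weighted_norm_sq G (u - (\<gamma> * \<alpha>) *\<^sub>R w)
      = weighted_norm_sq G u - 2 * (\<gamma> * \<alpha>) * (u \<bullet> (G *v w)) + \<gamma>\<^sup>2 * \<alpha> * (\<alpha> * ?V)"
    by (simp add: weighted_norm_sq_def matrix_vector_mult_diff_distrib matrix_vector_mult_scaleR
        inner_diff_left inner_diff_right swap power2_eq_square algebra_simps)
  also have "\<dots> \<le> weighted_norm_sq G u - 2 * (\<gamma> * \<alpha>) * \<epsilon> + \<gamma>\<^sup>2 * \<alpha> * \<epsilon>"
    using slope \<gamma> \<alpha> by simp
  also have "\<dots> = weighted_norm_sq G u - \<gamma> * (2 - \<gamma>) * \<alpha> * \<epsilon>"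
    by (simp add: power2_eq_square algebra_simps)
  finally show ?thesis using gain by (simp add: \<alpha>_def)
qed simp

section \<open>Convergence of Fejer monotone sequences\<close>

text \<open>Boundedness yields a cluster point \<open>l\<close>, which lies in \<open>S\<close>; the distance to \<open>l\<close> is
  nonincreasing and tends to zero along a subsequence, hence tends to zero.\<close>

lemma fejer_convergent:
  fixes x :: "nat \<Rightarrow> 'a::euclidean_space" and V :: "'a \<Rightarrow> real"
  assumes V: "continuous_on UNIV V" "V 0 = 0" "\<And>z. (norm z)\<^sup>2 \<le> V z"
    and "c > 0" and e: "\<And>k. 0 \<le> e k"
    and dec: "\<And>s k. s \<in> S \<Longrightarrow> V (x (Suc k) - s) \<le> V (x k - s) - c * e k"
    and "S \<noteq> {}"
    and cluster: "\<And>r l. e \<longlonglongrightarrow> 0 \<Longrightarrow> strict_mono r \<Longrightarrow> (x \<circ> r) \<longlonglongrightarrow> l \<Longrightarrow> l \<in> S"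
  shows "\<exists>l\<in>S. x \<longlonglongrightarrow> l"
proof -
  obtain s where s: "s \<in> S" using \<open>S \<noteq> {}\<close> by blast
  have Vpos: "0 \<le> V z" for z using V(3)[of z] zero_le_power2[of "norm z"] by linarith
  have decr: "decseq (\<lambda>k. V (x k - t))" if "t \<in> S" for t
  proof (rule decseq_SucI)
    fix k
    have "0 \<le> c * e k" using \<open>c > 0\<close> e[of k] by simp
    then show "V (x (Suc k) - t) \<le> V (x k - t)" using dec[OF that, of k] by linarith
  qed
  have conv: "convergent (\<lambda>k. V (x k - t))" if "t \<in> S" for t
  proof -
    have "Bseq (\<lambda>k. V (x k - t))"
      using decseq_bounded[OF decr[OF that], of 0] Vpos by simp
    then show ?thesis using decr[OF that] by (intro Bseq_monoseq_convergent decseq_imp_monoseq)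
  qed
  obtain L where L: "(\<lambda>k. V (x k - s)) \<longlonglongrightarrow> L" using conv[OF s] by (auto simp: convergent_def)
  have "(\<lambda>k. (V (x k - s) - V (x (Suc k) - s)) / c) \<longlonglongrightarrow> (L - L) / c"
    using \<open>c > 0\<close> by (intro tendsto_intros L LIMSEQ_Suc[OF L]) auto
  then have "(\<lambda>k. (V (x k - s) - V (x (Suc k) - s)) / c) \<longlonglongrightarrow> 0" by simp
  then have e0: "e \<longlonglongrightarrow> 0"
  proof (rule tendsto_sandwich[OF _ _ tendsto_const, rotated 2])
    show "\<forall>\<^sub>F k in sequentially. e k \<le> (V (x k - s) - V (x (Suc k) - s)) / c"
    proof (rule always_eventually, rule allI)
      fix k
      show "e k \<le> (V (x k - s) - V (x (Suc k) - s)) / c"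
        using dec[OF s, of k] \<open>c > 0\<close> by (simp add: field_simps)
    qed
  qed (simp add: e)
  have "norm (x k) \<le> norm s + sqrt (V (x 0 - s))" for k
  proof -
    have "V (x k - s) \<le> V (x 0 - s)" using decseqD[OF decr[OF s], of 0 k] by simp
    with V(3)[of "x k - s"] have "norm (x k - s) \<le> sqrt (V (x 0 - s))"
      by (intro real_le_rsqrt) linarith
    then show ?thesis using norm_triangle_sub[of "x k" s] by linarith
  qed
  then have "bounded (range x)" by (auto intro: boundedI)
  then obtain r l where r: "strict_mono r" "(x \<circ> r) \<longlonglongrightarrow> l"
    using bounded_imp_convergent_subsequence by blast
  have l: "l \<in> S" using cluster[OF e0 r] .
  obtain L' where L': "(\<lambda>k. V (x k - l)) \<longlonglongrightarrow> L'" using conv[OF l] by (auto simp: convergent_def)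
  have "(\<lambda>k. V ((x \<circ> r) k - l)) \<longlonglongrightarrow> V (l - l)"
    by (intro continuous_on_tendsto_compose[OF V(1)] tendsto_diff r(2) tendsto_const) auto
  moreover have "(\<lambda>k. V ((x \<circ> r) k - l)) \<longlonglongrightarrow> L'"
    using LIMSEQ_subseq_LIMSEQ[OF L' r(1)] by (simp add: o_def)
  ultimately have "V (l - l) = L'" by (rule LIMSEQ_unique)
  then have "L' = 0" using V(2) by simp
  then have "(\<lambda>k. sqrt (V (x k - l))) \<longlonglongrightarrow> 0" using tendsto_real_sqrt[OF L'] by simp
  moreover have "norm (x k - l) \<le> sqrt (V (x k - l))" for k by (rule real_le_rsqrt[OF V(3)])
  ultimately have "(\<lambda>k. x k - l) \<longlonglongrightarrow> 0"
    using Lim_null_comparison[of "\<lambda>k. x k - l" "\<lambda>k. sqrt (V (x k - l))" sequentially] by simp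
  then have "x \<longlonglongrightarrow> l" by (rule LIM_zero_cancel)
  then show ?thesis using l by blast
qed

section \<open>The two algorithms as one method\<close>

text \<open>The cluster points are solutions because the residuals vanish, hence so does
  \<open>(x k - p k) / \<beta> k\<close> as the step sizes stay away from zero.  The update rule covers a vanishing
  residual as well: the step is then zero.\<close>

lemma prediction_correction_convergent:
  fixes \<theta> :: "real ^ 'n \<Rightarrow> ereal" and G M :: "real ^ 'n ^ 'n" and x p w :: "nat \<Rightarrow> real ^ 'n"
  assumes cpc: "closed_proper_convex \<theta>" and psd: "pos_semidef M"
    and sol: "MGVI_solution \<theta> (affine_map M q) xs"
    and \<gamma>: "0 < \<gamma>" "\<gamma> < 2"
    and G: "transpose G = G" "\<And>z. (norm z)\<^sup>2 \<le> weighted_norm_sq G z"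
    and \<beta>: "0 < b" "\<And>k. b \<le> \<beta> k"
    and p: "\<And>k. p k = predictor \<theta> (affine_map M q) (\<beta> k) (x k)"
    and w: "\<And>k. G *v w k = (mat 1 + \<beta> k *\<^sub>R transpose M) *v (x k - p k)"
    and K: "0 < K" "\<And>k. weighted_norm_sq G (w k) \<le> K * (norm (x k - p k))\<^sup>2"
    and step: "\<And>k. x (Suc k) =
      x k - (\<gamma> * ((norm (x k - p k))\<^sup>2 / weighted_norm_sq G (w k))) *\<^sub>R w k"
  shows "\<exists>l. MGVI_solution \<theta> (affine_map M q) l \<and> x \<longlonglongrightarrow> l"
proof -
  let ?F = "affine_map M q"
  define S where "S = {l. MGVI_solution \<theta> ?F l}"
  define c where "c = \<gamma> * (2 - \<gamma>) / K"
  define e where "e k = (norm (x k - p k))\<^sup>2" for k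
  have \<beta>pos: "0 < \<beta> k" for k using \<beta>(1) \<beta>(2)[of k] by linarith
  have "\<exists>l\<in>S. x \<longlonglongrightarrow> l"
  proof (rule fejer_convergent[where V = "weighted_norm_sq G" and c = c and e = e])
    show "continuous_on UNIV (weighted_norm_sq G)"
      unfolding weighted_norm_sq_def
      by (intro continuous_intros linear_continuous_on matrix_vector_mul_bounded_linear)
    show "weighted_norm_sq G 0 = 0" by (simp add: weighted_norm_sq_def)
    show "(norm z)\<^sup>2 \<le> weighted_norm_sq G z" for z by (rule G)
    show "c > 0" using \<gamma> K(1) by (simp add: c_def)
    show "0 \<le> e k" for k by (simp add: e_def)
    show "S \<noteq> {}" using sol by (auto simp: S_def)
  next
    fix s k assume "s \<in> S"
    then have "MGVI_solution \<theta> ?F s" by (simp add: S_def)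
    from predictor_descent[OF cpc psd \<beta>pos this p]
    have slope: "e k \<le> (x k - s) \<bullet> (G *v w k)" by (simp add: w e_def)
    have "x (Suc k) - s = (x k - s) - (\<gamma> * (e k / weighted_norm_sq G (w k))) *\<^sub>R w k"
      by (simp add: step e_def)
    moreover have "0 \<le> e k" "weighted_norm_sq G (w k) \<le> K * e k" using K(2) by (auto simp: e_def)
    ultimately show "weighted_norm_sq G (x (Suc k) - s) \<le> weighted_norm_sq G (x k - s) - c * e k"
      using relaxed_step_decrease[OF G \<gamma> _ slope K(1)] by (simp only: c_def)
  next
    fix r :: "nat \<Rightarrow> nat" and l
    assume e0: "e \<longlonglongrightarrow> 0" and r: "strict_mono r" and l: "(x \<circ> r) \<longlonglongrightarrow> l"
    have "(\<lambda>k. sqrt (e k)) \<longlonglongrightarrow> 0" using tendsto_real_sqrt[OF e0] by simp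
    then have "(\<lambda>k. norm (x k - p k)) \<longlonglongrightarrow> 0" by (simp add: e_def)
    then have res: "(\<lambda>k. x k - p k) \<longlonglongrightarrow> 0" by (rule tendsto_norm_zero_cancel)
    have "(\<lambda>k. (1 / \<beta> k) *\<^sub>R (x k - p k)) \<longlonglongrightarrow> 0"
    proof (rule Lim_null_comparison)
      show "(\<lambda>k. (1 / b) * norm (x k - p k)) \<longlonglongrightarrow> 0"
        using tendsto_mult_right_zero[OF tendsto_norm_zero[OF res]] .
      show "\<forall>\<^sub>F k in sequentially.
          norm ((1 / \<beta> k) *\<^sub>R (x k - p k)) \<le> (1 / b) * norm (x k - p k)"
      proof (rule always_eventually, rule allI)
        fix k
        have "1 / \<beta> k \<le> 1 / b" using \<beta>(1) \<beta>(2)[of k] by (intro divide_left_mono) auto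
        from mult_right_mono[OF this norm_ge_zero[of "x k - p k"]] \<beta>pos[of k]
        show "norm ((1 / \<beta> k) *\<^sub>R (x k - p k)) \<le> (1 / b) * norm (x k - p k)" by simp
      qed
    qed
    from LIMSEQ_subseq_LIMSEQ[OF this r]
    have res': "(\<lambda>k. (1 / \<beta> (r k)) *\<^sub>R (x (r k) - p (r k))) \<longlonglongrightarrow> 0" by (simp add: o_def)
    have xr: "(\<lambda>k. x (r k)) \<longlonglongrightarrow> l" using l by (simp add: o_def)
    have "(\<lambda>k. x (r k) - (x (r k) - p (r k))) \<longlonglongrightarrow> l - 0"
      using LIMSEQ_subseq_LIMSEQ[OF res r] by (intro tendsto_diff xr) (simp add: o_def)
    then have pr: "(\<lambda>k. p (r k)) \<longlonglongrightarrow> l" by simp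
    have "(\<lambda>k. ?F (x (r k))) \<longlonglongrightarrow> ?F l"
      unfolding affine_map_def
      by (intro tendsto_intros bounded_linear.tendsto[OF matrix_vector_mul_bounded_linear] xr)
    from tendsto_diff[OF this res']
    have "(\<lambda>k. ?F (x (r k)) - (1 / \<beta> (r k)) *\<^sub>R (x (r k) - p (r k))) \<longlonglongrightarrow> ?F l" by simp
    then have "MGVI_solution \<theta> (\<lambda>_. ?F l) l"
      by (rule MGVI_solution_limit[OF cpc predictor_subgradient[OF cpc \<beta>pos sol p] pr])
    then have "MGVI_solution \<theta> ?F l" by (rule iffD2[OF MGVI_solution_const])
    then show "l \<in> S" by (simp add: S_def)
  qed
  then show ?thesis by (auto simp: S_def)
qed

text \<open>The bound is uniform over \<open>\<beta> \<le> B\<close>; it supplies the constant \<open>K\<close> for both algorithms.\<close>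

lemma norm_mult_metric_le:
  fixes M :: "real ^ 'n ^ 'n"
  assumes "0 \<le> \<beta>" "\<beta> \<le> B"
  shows "norm ((mat 1 + \<beta> *\<^sub>R transpose M) *v z) \<le> (1 + B * onorm ((*v) (transpose M))) * norm z"
proof -
  let ?N = "onorm ((*v) (transpose M))"
  have "norm ((mat 1 + \<beta> *\<^sub>R transpose M) *v z) \<le> norm z + norm (\<beta> *\<^sub>R (transpose M *v z))"
    by (simp add: matrix_vector_mult_add_rdistrib scaleR_matrix_vector_assoc[symmetric]
        norm_triangle_le)
  also have "norm (\<beta> *\<^sub>R (transpose M *v z)) = \<beta> * norm (transpose M *v z)" using assms by simp
  also have "\<dots> \<le> B * (?N * norm z)"
    using assms by (intro mult_mono onorm matrix_vector_mul_bounded_linear) auto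
  finally show ?thesis by (simp add: algebra_simps)
qed

theorem theorem4p1:
  fixes \<theta> :: "real ^ 'n \<Rightarrow> ereal"
    and M :: "real ^ 'n ^ 'n"
    and q :: "real ^ 'n"
    and \<gamma> :: real
  assumes "closed_proper_convex \<theta>"
    and "\<exists>xs. MGVI_solution \<theta> (affine_map M q) xs"
    and "0 < \<gamma>" and "\<gamma> < 2"
  shows "(pos_semidef M \<longrightarrow>
           (\<forall>(\<beta> :: nat \<Rightarrow> real) (x :: nat \<Rightarrow> real ^ 'n).
              bounded (range \<beta>) \<longrightarrow> (INF k. \<beta> k) > 0 \<longrightarrow> PGA_a1 \<theta> M q \<gamma> \<beta> x \<longrightarrow>
              (\<exists>xs. MGVI_solution \<theta> (affine_map M q) xs \<and> x \<longlonglongrightarrow> xs)))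
       \<and> (transpose M = M \<and> pos_semidef M \<longrightarrow>
           (\<forall>(\<beta> :: real) (y :: nat \<Rightarrow> real ^ 'n).
              \<beta> > 0 \<longrightarrow> PGA_a2 \<theta> M q \<gamma> \<beta> y \<longrightarrow>
              (\<exists>xs. MGVI_solution \<theta> (affine_map M q) xs \<and> y \<longlonglongrightarrow> xs)))"
proof -
  note cpc = assms(1) and \<gamma> = assms(3,4)
  obtain xs where sol: "MGVI_solution \<theta> (affine_map M q) xs" using assms(2) by blast
  define N where "N = onorm ((*v) (transpose M))"
  have N: "N \<ge> 0" unfolding N_def by (intro onorm_pos_le matrix_vector_mul_bounded_linear)
  show ?thesis
  proof (intro conjI impI allI; (elim conjE)?)
    fix \<beta> :: "nat \<Rightarrow> real" and x
    assume psd: "pos_semidef M" and bdd: "bounded (range \<beta>)" and inf: "(INF k. \<beta> k) > 0"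
      and alg: "PGA_a1 \<theta> M q \<gamma> \<beta> x"
    define p where "p k = predictor \<theta> (affine_map M q) (\<beta> k) (x k)" for k
    let ?d = "\<lambda>k. (mat 1 + \<beta> k *\<^sub>R transpose M) *v (x k - p k)"
    have step: "x (Suc k) = (if x k = p k then x k
        else x k - (\<gamma> * ((norm (x k - p k))\<^sup>2 / (norm (?d k))\<^sup>2)) *\<^sub>R ?d k)" for k
      using alg unfolding PGA_a1_def Let_def p_def by blast
    have pos: "\<beta> k > 0" for k using alg by (simp add: PGA_a1_def Let_def)
    have low: "(INF k. \<beta> k) \<le> \<beta> k" for k
      by (intro cINF_lower bounded_imp_bdd_below bdd) simp
    obtain B where B: "\<bar>\<beta> k\<bar> \<le> B" for k using bdd by (auto simp: bounded_iff)
    have B': "\<beta> k \<le> B" for k using B[of k] by linarith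
    have "B \<ge> 0" using B[of 0] by linarith
    have wns: "weighted_norm_sq (mat 1) z = (norm z)\<^sup>2" for z :: "real ^ 'n"
      by (simp add: weighted_norm_sq_def power2_norm_eq_inner)
    show "\<exists>xs. MGVI_solution \<theta> (affine_map M q) xs \<and> x \<longlonglongrightarrow> xs"
    (* The Euclidean metric; the correction direction is d itself. *)
    proof (rule prediction_correction_convergent[OF cpc psd sol \<gamma>, where G = "mat 1" and w = ?d
          and p = p and K = "(1 + B * N)\<^sup>2" and \<beta> = \<beta>
          and b = "INF k. \<beta> k"])
      show "0 < (1 + B * N)\<^sup>2" using N \<open>B \<ge> 0\<close>
        by (intro zero_less_power add_pos_nonneg mult_nonneg_nonneg) auto
      show "weighted_norm_sq (mat 1) (?d k) \<le> (1 + B * N)\<^sup>2 * (norm (x k - p k))\<^sup>2" for k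
        using norm_mult_metric_le[OF less_imp_le[OF pos] B', of k M "x k - p k"]
        unfolding wns power_mult_distrib[symmetric] by (intro power_mono) (auto simp: N_def)
      show "x (Suc k) = x k -
          (\<gamma> * ((norm (x k - p k))\<^sup>2 / weighted_norm_sq (mat 1) (?d k))) *\<^sub>R ?d k" for k
        using step[of k] by (cases "x k = p k") (simp_all add: wns)
    qed (use inf low in \<open>auto simp: wns p_def transpose_mat\<close>)
  next
    fix \<beta> :: real and y
    assume sym: "transpose M = M" and psd: "pos_semidef M" and \<beta>: "\<beta> > 0"
      and alg: "PGA_a2 \<theta> M q \<gamma> \<beta> y"
    define p where "p k = predictor \<theta> (affine_map M q) \<beta> (y k)" for k
    let ?e = "\<lambda>k. y k - p k"
    let ?G = "mat 1 + \<beta> *\<^sub>R transpose M"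
    have step: "y (Suc k) = (if y k = p k then y k
        else y k - (\<gamma> * ((norm (?e k))\<^sup>2 / weighted_norm_sq ?G (?e k))) *\<^sub>R ?e k)" for k
      using alg unfolding PGA_a2_def Let_def p_def by blast
    show "\<exists>xs. MGVI_solution \<theta> (affine_map M q) xs \<and> y \<longlonglongrightarrow> xs"
    (* The matrix G moves from the direction into the metric, which needs M symmetric. *)
    proof (rule prediction_correction_convergent[OF cpc psd sol \<gamma>, where G = ?G and w = ?e
          and p = p and K = "1 + \<beta> * N" and \<beta> = "\<lambda>_. \<beta>" and b = \<beta>])
      show "transpose ?G = ?G"
        using sym by (simp add: transpose_def vec_eq_iff mat_def)
      show "(norm z)\<^sup>2 \<le> weighted_norm_sq ?G z" for z
        using psd \<beta> sym
        by (simp add: weighted_norm_sq_def power2_norm_eq_inner matrix_vector_mult_add_rdistrib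
            scaleR_matrix_vector_assoc[symmetric] inner_add_right pos_semidef_def)
      show "0 < 1 + \<beta> * N" using N \<beta> by (simp add: add_pos_nonneg)
      show "weighted_norm_sq ?G (?e k) \<le> (1 + \<beta> * N) * (norm (?e k))\<^sup>2" for k
      proof -
        have "weighted_norm_sq ?G (?e k) \<le> norm (?e k) * norm (?G *v ?e k)"
          unfolding weighted_norm_sq_def by (rule norm_cauchy_schwarz)
        also have "\<dots> \<le> norm (?e k) * ((1 + \<beta> * N) * norm (?e k))"
          using norm_mult_metric_le[of \<beta> \<beta> M "?e k"] \<beta> by (intro mult_left_mono) (auto simp: N_def)
        finally show ?thesis by (simp add: power2_eq_square algebra_simps)
      qed
      show "y (Suc k) = y k - (\<gamma> * ((norm (?e k))\<^sup>2 / weighted_norm_sq ?G (?e k))) *\<^sub>R ?e k" for k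
        using step[of k] by (cases "y k = p k") simp_all
    qed (use \<beta> in \<open>auto simp: p_def\<close>)
  qed
qed

end
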